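(* Let $P$ and $Q$ be polynomial expressions in the variables $\lambda_1,\dots,\lambda_m$. Assume that the identity $P=Q$ holds in all commutative rings. If the identity $P\ge Q$ holds in all commutative tropical algebras, then the identity $P\vDash Q$ holds in all commutative ELT rings, i.e. for every commutative ELT ring $\mathcal R$ and all $r_1,\dots,r_m\in\overline{\mathcal R}$ one has $P(r_1,\dots,r_m)\vDash Q(r_1,\dots,r_m)$.
   Context: Polynomial expressions: a positive polynomial expression in $\lambda_1,\dots,\lambda_m$ is a formal expression built from the symbols $0,1,\lambda_1,\dots,\lambda_m$ by finitely many formal additions and multiplications. A polynomial expression is a formal expression $P=P^+-P^-$ with $P^+,P^-$ positive polynomial expressions. A negation map on a semiring $R$ is a map $(-):R\to R$ with $(-)(a+b)=(-)a+(-)b$, $(-)0_R=0_R$, $(-)(ab)=a((-)b)=((-)a)b$ and $(-)((-)a)=a$. A polynomial expression is evaluated at $r_1,\dots,r_m\in R$ by $P(r)=P^+(r)+\big((-)P^-(r)\big)$, where the symbols $0,1$ are interpreted as the zero and unit of $R$. An identity $P=Q$ (or $P\ge Q$, $P\vDash Q$) holds in $R$ if the corresponding relation between $P(r_1,\dots,r_m)$ and $Q(r_1,\dots,r_m)$ holds for all $r_1,\dots,r_m\in R$. Commutative rings are taken with the negation map $(-)a=-a$. Commutative tropical algebras: for a totally ordered abelian group $G$, the max-plus algebra $\overline{G_{\max}}=G\cup\{-\infty\}$ with $a\oplus b=\max\{a,b\}$ and $a\odot b$ the group operation of $G$, where $-\infty$ is smaller than every element of $G$ and is absorbing for $\odot$;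 it is taken with the trivial negation map $(-)a=a$, and $\ge$ is its total order. Commutative ELT rings: let $F$ be a totally ordered abelian group (written additively) and $L$ a commutative ring with unit. The commutative ELT ring $\mathcal R=\mathscr R(L,F)$ is the set of symbols ${}^{[\ell]}a$ ($a\in F$, $\ell\in L$) with multiplication ${}^{[\ell_1]}a_1\cdot{}^{[\ell_2]}a_2={}^{[\ell_1\ell_2]}(a_1+a_2)$ and addition ${}^{[\ell_1]}a_1+{}^{[\ell_2]}a_2$ equal to ${}^{[\ell_1]}a_1$ if $a_1>a_2$, to ${}^{[\ell_2]}a_2$ if $a_1<a_2$, and to ${}^{[\ell_1+\ell_2]}a_1$ if $a_1=a_2$. The layer of ${}^{[\ell]}a$ is $s({}^{[\ell]}a)=\ell$. Set $\overline{\mathcal R}=\mathcal R\cup\{-\infty\}$, where $-\infty+\alpha=\alpha+(-\infty)=\alpha$, $-\infty\cdot\alpha=\alpha\cdot(-\infty)=-\infty$ and $s(-\infty)=0$; this is a commutative semiring with zero $-\infty$ and unit ${}^{[1]}0$. Its negation map is $(-)\alpha={}^{[-1]}0\cdot\alpha$, i.e. $(-)\,{}^{[\ell]}a={}^{[-\ell]}a$. For $x,y\in\overline{\mathcal R}$, $x\vDash y$ means that $x=y+z$ for some $z\in\overline{\mathcal R}$ with $s(z)=0$. *)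

theory Defs
  imports "HOL-Algebra.Ring" "HOL-Library.Infinite_Typeclass"
begin

subsection \<open>Polynomial expressions\<close>

datatype (pos_vars: 'v) pos_expr =
    EZero
  | EOne
  | EVar 'v
  | EAdd "'v pos_expr" "'v pos_expr"
  | EMul "'v pos_expr" "'v pos_expr"

text \<open>\<open>PolyExpr A B\<close> is the formal difference of \<open>A\<close> and \<open>B\<close>.\<close>

datatype (poly_vars: 'v) poly_expr = PolyExpr "'v pos_expr" "'v pos_expr"

primrec pos_eval :: "('a, 'b) ring_scheme \<Rightarrow> ('v \<Rightarrow> 'a) \<Rightarrow> 'v pos_expr \<Rightarrow> 'a" where
  "pos_eval R r EZero = \<zero>\<^bsub>R\<^esub>"
| "pos_eval R r EOne = \<one>\<^bsub>R\<^esub>"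
| "pos_eval R r (EVar v) = r v"
| "pos_eval R r (EAdd A B) = pos_eval R r A \<oplus>\<^bsub>R\<^esub> pos_eval R r B"
| "pos_eval R r (EMul A B) = pos_eval R r A \<otimes>\<^bsub>R\<^esub> pos_eval R r B"

primrec poly_eval ::
  "('a, 'b) ring_scheme \<Rightarrow> ('a \<Rightarrow> 'a) \<Rightarrow> ('v \<Rightarrow> 'a) \<Rightarrow> 'v poly_expr \<Rightarrow> 'a" where
  "poly_eval R neg r (PolyExpr A B) = pos_eval R r A \<oplus>\<^bsub>R\<^esub> neg (pos_eval R r B)"

text \<open>
  The relation \<open>rel\<close> holds between \<open>P\<close> and \<open>Q\<close>, as expressions in the variables with
  indices \<open>1, \<dots>, m\<close>, throughout the semiring \<open>R\<close> with negation map \<open>neg\<close>.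
  HOL cannot quantify over types inside a hypothesis, so an identity in all semirings of some kind
  is assumed for all those carried by subsets of one arbitrary infinite type, used as a universe.
\<close>

definition identity_holds ::
  "nat \<Rightarrow> ('a, 'b) ring_scheme \<Rightarrow> ('a \<Rightarrow> 'a) \<Rightarrow> ('a \<Rightarrow> 'a \<Rightarrow> bool) \<Rightarrow>
    nat poly_expr \<Rightarrow> nat poly_expr \<Rightarrow> bool" where
  "identity_holds m R neg rel P Q \<longleftrightarrow>
    (\<forall>r. (\<forall>i\<in>{1..m}. r i \<in> carrier R) \<longrightarrow> rel (poly_eval R neg r P) (poly_eval R neg r Q))"


subsection \<open>Totally ordered abelian groups\<close>

text \<open>The group is written multiplicatively; \<open>(a, b) \<in> leq\<close> means that \<open>a\<close> is at most \<open>b\<close>.\<close>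

locale totally_ordered_abelian_group = comm_group G for G (structure) +
  fixes leq :: "('a \<times> 'a) set"
  assumes linear_order: "linear_order_on (carrier G) leq"
    and mult_le_mono: "\<lbrakk>(a, b) \<in> leq; c \<in> carrier G\<rbrakk> \<Longrightarrow> (a \<otimes> c, b \<otimes> c) \<in> leq"


subsection \<open>Adjoining minus infinity\<close>

text \<open>
  \<open>None\<close> plays the role of minus infinity: neutral for the addition, absorbing for the
  multiplication.
\<close>

definition adjoin_bot ::
  "'a set \<Rightarrow> ('a \<Rightarrow> 'a \<Rightarrow> 'a) \<Rightarrow> ('a \<Rightarrow> 'a \<Rightarrow> 'a) \<Rightarrow> 'a \<Rightarrow> 'a option ring" where
  "adjoin_bot A ad mu un =
    \<lparr>carrier = insert None (Some ` A),
     mult = (\<lambda>x y. case (x, y) of (Some a, Some b) \<Rightarrow> Some (mu a b) | _ \<Rightarrow> None),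
     one = Some un,
     zero = None,
     add = (\<lambda>x y. case (x, y) of
       (Some a, Some b) \<Rightarrow> Some (ad a b)
     | (None, _) \<Rightarrow> y
     | (_, None) \<Rightarrow> x)\<rparr>"


subsection \<open>Max-plus algebras\<close>

definition max_plus :: "('a, 'b) monoid_scheme \<Rightarrow> ('a \<times> 'a) set \<Rightarrow> 'a option ring" where
  "max_plus G leq =
    adjoin_bot (carrier G) (\<lambda>a b. if (a, b) \<in> leq then b else a) (mult G) \<one>\<^bsub>G\<^esub>"

fun max_plus_ge :: "('a \<times> 'a) set \<Rightarrow> 'a option \<Rightarrow> 'a option \<Rightarrow> bool" where
  "max_plus_ge leq x None \<longleftrightarrow> True"
| "max_plus_ge leq None (Some b) \<longleftrightarrow> False"
| "max_plus_ge leq (Some a) (Some b) \<longleftrightarrow> (b, a) \<in> leq"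


subsection \<open>ELT rings\<close>

text \<open>The pair \<open>(l, a)\<close> stands for the symbol with layer \<open>l\<close> and tangible value \<open>a\<close>.\<close>

fun elt_mult ::
  "('l, 'b) ring_scheme \<Rightarrow> ('f, 'c) monoid_scheme \<Rightarrow> 'l \<times> 'f \<Rightarrow> 'l \<times> 'f \<Rightarrow> 'l \<times> 'f" where
  "elt_mult L F (l1, a1) (l2, a2) = (l1 \<otimes>\<^bsub>L\<^esub> l2, a1 \<otimes>\<^bsub>F\<^esub> a2)"

fun elt_add ::
  "('l, 'b) ring_scheme \<Rightarrow> ('f \<times> 'f) set \<Rightarrow> 'l \<times> 'f \<Rightarrow> 'l \<times> 'f \<Rightarrow> 'l \<times> 'f" where
  "elt_add L leq (l1, a1) (l2, a2) =
    (if a1 = a2 then (l1 \<oplus>\<^bsub>L\<^esub> l2, a1)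
     else if (a2, a1) \<in> leq then (l1, a1)
     else (l2, a2))"

text \<open>The ELT ring with minus infinity adjoined.\<close>

definition elt_ring ::
  "('l, 'b) ring_scheme \<Rightarrow> ('f, 'c) monoid_scheme \<Rightarrow> ('f \<times> 'f) set \<Rightarrow> ('l \<times> 'f) option ring" where
  "elt_ring L F leq =
    adjoin_bot (carrier L \<times> carrier F) (elt_add L leq) (elt_mult L F) (\<one>\<^bsub>L\<^esub>, \<one>\<^bsub>F\<^esub>)"

definition elt_neg ::
  "('l, 'b) ring_scheme \<Rightarrow> ('f, 'c) monoid_scheme \<Rightarrow> ('f \<times> 'f) set \<Rightarrow>
    ('l \<times> 'f) option \<Rightarrow> ('l \<times> 'f) option" where
  "elt_neg L F leq x = Some (\<ominus>\<^bsub>L\<^esub> \<one>\<^bsub>L\<^esub>, \<one>\<^bsub>F\<^esub>) \<otimes>\<^bsub>elt_ring L F leq\<^esub> x"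

fun elt_layer :: "('l, 'b) ring_scheme \<Rightarrow> ('l \<times> 'f) option \<Rightarrow> 'l" where
  "elt_layer L None = \<zero>\<^bsub>L\<^esub>"
| "elt_layer L (Some (l, a)) = l"

definition elt_surpasses ::
  "('l, 'b) ring_scheme \<Rightarrow> ('f, 'c) monoid_scheme \<Rightarrow> ('f \<times> 'f) set \<Rightarrow>
    ('l \<times> 'f) option \<Rightarrow> ('l \<times> 'f) option \<Rightarrow> bool" where
  "elt_surpasses L F leq x y \<longleftrightarrow>
    (\<exists>z\<in>carrier (elt_ring L F leq). elt_layer L z = \<zero>\<^bsub>L\<^esub> \<and> x = y \<oplus>\<^bsub>elt_ring L F leq\<^esub> z)"

end

theory Submission
  imports Defs "HOL-Algebra.Weak_Morphisms" "HOL-Algebra.Subrings" "HOL-Algebra.Product_Groups"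
    "HOL-Library.Countable_Set"
begin

text \<open>
  An element \<open>[l]a\<close> of an ELT ring records a leading term: the exponent \<open>a\<close> and the coefficient \<open>l\<close>
  of the dominant monomial of some element of a genuine ring graded by \<open>F\<close>. The idea of the proof
  is to lift each \<open>r\<^sub>i\<close> to such a genuine ring, apply the ring identity there, and read off leading
  terms again.

  The lift of \<open>[l]a\<close> is the weighted shift \<open>f \<mapsto> (x \<mapsto> l * f (x - a))\<close> on the functions \<open>F \<rightarrow> L\<close>, and
  that of minus infinity is the zero operator. These operators play the role of the monomials
  of the group algebra \<open>L[F]\<close>: they lie in the endomorphism ring of an abelian group, a ring whose
  axioms come almost for free, and they commute with each other, so they generate a commutative
  ring. (The group \<open>F\<close> is written additively in this explanation, multiplicatively in the lemmas.)
  An operator \<open>\<phi>\<close> has leading term \<open>[l]a\<close> if it maps a function vanishing above \<open>s\<close> to one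
  vanishing above \<open>a + s\<close>, the value at \<open>s\<close> being multiplied by \<open>l\<close> on its way to \<open>a + s\<close>. The
  layer \<open>l = 0\<close> is permitted, and this makes the notion compatible with sum, product and negation without exception
  (\<open>has_leading_term_add\<close>, \<open>has_leading_term_mult\<close>, \<open>has_leading_term_uminus\<close>). Hence the value of
  \<open>P\<close> in the ELT ring is a leading term of the value of \<open>P\<close> at the operators, and likewise for \<open>Q\<close>.

  By the ring identity both operators are the same operator \<open>\<phi>\<close>. By the tropical inequality the
  exponent of \<open>P(r)\<close> is at least that of \<open>Q(r)\<close>, where minus infinity counts as the smallest
  exponent. Applying \<open>\<phi>\<close> to the delta function at \<open>0\<close> shows that equal exponents force equal
  layers, and that otherwise \<open>P(r)\<close> has layer \<open>0\<close>, because the image vanishes above the exponent of \<open>Q(r)\<close>; then \<open>P(r) = Q(r) + P(r)\<close>. Both cases give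
  \<open>P(r) \<Turnstile> Q(r)\<close> (\<open>elt_surpasses_if_same_operator\<close>).

  The two hypotheses concern structures carried by one infinite type only. An evaluation takes
  place inside a countable subring or subgroup, and a countable structure can be copied along an
  injection into any infinite type. This extends both hypotheses to rings and groups of every
  size (\<open>ring_identity_at_commuting\<close>, \<open>tropical_inequality_everywhere\<close>).
\<close>

section \<open>Evaluation of expressions\<close>

text \<open>
  Parametricity of evaluation. Instances of \<open>rel\<close> below are closure of a subset, the graph of a
  homomorphism, commutation with an element, and being a leading term of an operator.
\<close>

lemma pos_eval_rel:
  assumes "rel \<zero>\<^bsub>R\<^esub> \<zero>\<^bsub>S\<^esub>" "rel \<one>\<^bsub>R\<^esub> \<one>\<^bsub>S\<^esub>"
    and "\<And>x x' y y'. rel x x' \<Longrightarrow> rel y y' \<Longrightarrow> rel (x \<oplus>\<^bsub>R\<^esub> y) (x' \<oplus>\<^bsub>S\<^esub> y')"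
    and "\<And>x x' y y'. rel x x' \<Longrightarrow> rel y y' \<Longrightarrow> rel (x \<otimes>\<^bsub>R\<^esub> y) (x' \<otimes>\<^bsub>S\<^esub> y')"
    and "\<And>v. rel (r v) (s v)"
  shows "rel (pos_eval R r A) (pos_eval S s A)"
  by (induction A) (simp_all add: assms)

lemma poly_eval_rel:
  assumes "rel \<zero>\<^bsub>R\<^esub> \<zero>\<^bsub>S\<^esub>" "rel \<one>\<^bsub>R\<^esub> \<one>\<^bsub>S\<^esub>"
    and "\<And>x x' y y'. rel x x' \<Longrightarrow> rel y y' \<Longrightarrow> rel (x \<oplus>\<^bsub>R\<^esub> y) (x' \<oplus>\<^bsub>S\<^esub> y')"
    and "\<And>x x' y y'. rel x x' \<Longrightarrow> rel y y' \<Longrightarrow> rel (x \<otimes>\<^bsub>R\<^esub> y) (x' \<otimes>\<^bsub>S\<^esub> y')"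
    and "\<And>x x'. rel x x' \<Longrightarrow> rel (neg x) (neg' x')"
    and "\<And>v. rel (r v) (s v)"
  shows "rel (poly_eval R neg r P) (poly_eval S neg' s P)"
  using pos_eval_rel[of rel R S r s, OF assms(1-4,6)] by (cases P) (simp add: assms(3,5))

lemma poly_eval_cong:
  assumes "\<And>v. v \<in> poly_vars P \<Longrightarrow> r v = s v"
  shows "poly_eval R neg r P = poly_eval R neg s P"
proof -
  have "pos_eval R r A = pos_eval R s A" if "\<forall>v\<in>pos_vars A. r v = s v" for A
    using that by (induction A) auto
  with assms show ?thesis
    by (cases P) auto
qed

text \<open>
  There are countably many expressions, so the values of all expressions at one point form a
  countable set.
\<close>

instance pos_expr :: (countable) countable
  by countable_datatype

instance poly_expr :: (countable) countable
  by countable_datatype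

lemma inj_on_countable_into_infinite:
  assumes "countable A"
  obtains \<phi> :: "'a \<Rightarrow> 'u::infinite" where "inj_on \<phi> A"
proof -
  obtain e :: "nat \<Rightarrow> 'u" where "inj e"
    using arb_countable_map[of "{}"] by blast
  then have "inj_on (e \<circ> to_nat_on A) A"
    by (intro comp_inj_on inj_on_to_nat_on assms) (rule inj_on_subset, auto)
  then show ?thesis
    by (rule that)
qed


section \<open>The ring identity at commuting elements of an arbitrary ring\<close>

context ring
begin

lemma pos_eval_closed:
  assumes "\<And>v. r v \<in> carrier R"
  shows "pos_eval R r A \<in> carrier R"
  using pos_eval_rel[of "\<lambda>x _. x \<in> carrier R" R R r r A] assms by simp

lemma pos_eval_commute:
  assumes r: "\<And>v. r v \<in> carrier R" and comm: "\<And>v w. r v \<otimes> r w = r w \<otimes> r v"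
  shows "pos_eval R r A \<otimes> pos_eval R r B = pos_eval R r B \<otimes> pos_eval R r A"
proof -
  let ?c = "\<lambda>y x _. x \<in> carrier R \<and> x \<otimes> y = y \<otimes> x"
  have step: "?c y (pos_eval R r C) ()"
    if y: "y \<in> carrier R" and "\<And>v. r v \<otimes> y = y \<otimes> r v" for y C
  proof (rule pos_eval_rel[of "?c y" R R r r])
    fix a b assume "a \<in> carrier R \<and> a \<otimes> y = y \<otimes> a" "b \<in> carrier R \<and> b \<otimes> y = y \<otimes> b"
    then show "a \<otimes> b \<in> carrier R \<and> a \<otimes> b \<otimes> y = y \<otimes> (a \<otimes> b)"
      using y by (metis m_assoc m_closed)
  qed (use that r in \<open>auto simp: l_distr r_distr\<close>)
  show ?thesis
    using step[of "pos_eval R r B" A] step[of "r v" B for v] r comm pos_eval_closed[of r B] by metis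
qed

text \<open>
  Sums, products and negatives of formal differences are again formal differences, and all positive
  expressions in commuting elements commute.
\<close>

lemma poly_values_subcring:
  assumes r: "\<And>v. r v \<in> carrier R" and comm: "\<And>v w. r v \<otimes> r w = r w \<otimes> r v"
  shows "subcring (range (poly_eval R (a_inv R) r)) R"
proof -
  let ?p = "pos_eval R r" and ?S = "range (poly_eval R (a_inv R) r)"
  note closed[simp] = pos_eval_closed[of r, OF r]
  have SI: "?p A \<ominus> ?p B \<in> ?S" for A B
    using rangeI[of "poly_eval R (a_inv R) r" "PolyExpr A B"] by (simp add: a_minus_def)
  have SE: "\<exists>A B. x = ?p A \<ominus> ?p B" if "x \<in> ?S" for x
    using that by (auto simp: a_minus_def) (metis poly_eval.simps poly_expr.exhaust)
  show ?thesis
  proof (intro subcringI subringI)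
    show "?S \<subseteq> carrier R"
      using SE by (metis closed minus_closed subsetI)
    show "\<one> \<in> ?S"
      using SI[of EOne EZero] by (simp add: a_minus_def)
  next
    fix x assume "x \<in> ?S"
    then obtain A B where "x = ?p A \<ominus> ?p B"
      using SE by blast
    then show "\<ominus> x \<in> ?S"
      using SI[of B A] by (simp add: a_minus_def minus_add a_comm)
  next
    fix x y assume "x \<in> ?S" "y \<in> ?S"
    then obtain A B C D where xy: "x = ?p A \<ominus> ?p B" "y = ?p C \<ominus> ?p D"
      by (meson SE)
    have "x \<otimes> y = ?p (EAdd (EMul A C) (EMul B D)) \<ominus> ?p (EAdd (EMul A D) (EMul B C))"
      unfolding xy by (simp add: a_minus_def l_distr r_distr l_minus r_minus minus_add a_ac)
    then show "x \<otimes> y \<in> ?S"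
      using SI by metis
    have "x \<oplus> y = ?p (EAdd A C) \<ominus> ?p (EAdd B D)"
      unfolding xy by (simp add: a_minus_def minus_add a_ac)
    then show "x \<oplus> y \<in> ?S"
      using SI by metis
    have "x \<otimes> ?p E = ?p E \<otimes> x" for E
      using pos_eval_commute[of r A E, OF r comm] pos_eval_commute[of r B E, OF r comm]
      unfolding xy by (simp add: a_minus_def l_distr r_distr l_minus r_minus)
    moreover have "x \<in> carrier R"
      unfolding xy by simp
    ultimately show "x \<otimes> y = y \<otimes> x"
      unfolding xy(2) by (simp add: a_minus_def l_distr r_distr l_minus r_minus)
  qed
qed

end

text \<open>
  The values of all expressions at the point form a countable commutative subring. A copy of it
  lives on the universe type, where the identity is known, and the copying map is injective.
\<close>

lemma ring_identity_at_commuting: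
  fixes R :: "('a, 'b) ring_scheme" (structure)
  assumes identity: "\<And>S :: ('u :: infinite) ring. cring S \<Longrightarrow> identity_holds m S (a_inv S) (=) P Q"
    and "ring R" and r: "\<And>v. r v \<in> carrier R"
    and comm: "\<And>v w. r v \<otimes> r w = r w \<otimes> r v"
  shows "poly_eval R (a_inv R) r P = poly_eval R (a_inv R) r Q"
proof -
  interpret ring R by fact
  define S where "S = range (poly_eval R (a_inv R) r)"
  have sub: "subcring S R"
    unfolding S_def using r comm by (rule poly_values_subcring)
  note SE = subcringE[OF sub]
  have "countable S"
    by (simp add: S_def)
  then obtain \<phi> :: "'a \<Rightarrow> 'u" where inj: "inj_on \<phi> S"
    by (rule inj_on_countable_into_infinite)
  define T where "T = image_ring \<phi> (R\<lparr>carrier := S\<rparr>)"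
  have iso: "\<phi> \<in> ring_iso (R\<lparr>carrier := S\<rparr>) T"
    unfolding T_def using inj by (intro inj_imp_image_ring_iso) simp
  have "cring (R\<lparr>carrier := S\<rparr>)"
    using subcring_iff sub SE(1) by blast
  then have "cring T"
    using cring.ring_iso_imp_img_cring[OF _ iso] by (simp add: T_def image_ring_def image_group_def monoid.defs)
  then interpret T: cring T .
  have add: "\<phi> (x \<oplus> y) = \<phi> x \<oplus>\<^bsub>T\<^esub> \<phi> y" and mult: "\<phi> (x \<otimes> y) = \<phi> x \<otimes>\<^bsub>T\<^esub> \<phi> y"
    if "x \<in> S" "y \<in> S" for x y
    using iso that by (auto simp: ring_iso_def ring_hom_def)
  have closed: "\<phi> x \<in> carrier T" if "x \<in> S" for x
    using iso that by (auto simp: ring_iso_def ring_hom_def)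
  have one: "\<phi> \<one> = \<one>\<^bsub>T\<^esub>" and zero: "\<phi> \<zero> = \<zero>\<^bsub>T\<^esub>"
    by (simp_all add: T_def image_ring_one image_ring_zero)
  have neg: "\<ominus>\<^bsub>T\<^esub> \<phi> x = \<phi> (\<ominus> x)" if "x \<in> S" for x
  proof (rule T.minus_equality)
    have "\<ominus> x \<in> S" "x \<in> carrier R"
      using that SE by auto
    then show "\<phi> (\<ominus> x) \<oplus>\<^bsub>T\<^esub> \<phi> x = \<zero>\<^bsub>T\<^esub>" "\<phi> (\<ominus> x) \<in> carrier T"
      using that closed by (simp_all flip: add zero add: l_neg)
    show "\<phi> x \<in> carrier T"
      using that by (rule closed)
  qed
  have rS: "r v \<in> S" for v
    unfolding S_def using r
    by (intro range_eqI[of _ _ "PolyExpr (EVar v) EZero"]) simp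
  have ev: "poly_eval R (a_inv R) r X \<in> S \<and> poly_eval T (a_inv T) (\<phi> \<circ> r) X = \<phi> (poly_eval R (a_inv R) r X)" for X
    by (rule poly_eval_rel[of "\<lambda>x y. x \<in> S \<and> y = \<phi> x"])
      (use SE rS in \<open>auto simp: add mult one zero neg\<close>)
  have "poly_eval T (a_inv T) (\<phi> \<circ> r) P = poly_eval T (a_inv T) (\<phi> \<circ> r) Q"
    using identity[OF \<open>cring T\<close>] closed rS by (simp add: identity_holds_def)
  then show ?thesis
    using ev inj by (metis inj_onD)
qed


section \<open>The tropical inequality in an arbitrary totally ordered group\<close>

context totally_ordered_abelian_group
begin

lemma leq_carrier: "(a, b) \<in> leq \<Longrightarrow> a \<in> carrier G \<and> b \<in> carrier G"
  using linear_order partial_order_onD(4) by (auto simp: linear_order_on_def)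

lemma leq_refl: "a \<in> carrier G \<Longrightarrow> (a, a) \<in> leq"
  using linear_order by (auto simp: linear_order_on_def partial_order_on_def preorder_on_def refl_on_def)

lemma leq_trans: "(a, b) \<in> leq \<Longrightarrow> (b, c) \<in> leq \<Longrightarrow> (a, c) \<in> leq"
  using linear_order by (auto simp: linear_order_on_def partial_order_on_def preorder_on_def dest: transD)

lemma leq_antisym: "(a, b) \<in> leq \<Longrightarrow> (b, a) \<in> leq \<Longrightarrow> a = b"
  using linear_order by (auto simp: linear_order_on_def partial_order_on_def dest: antisymD)

lemma leq_total: "a \<in> carrier G \<Longrightarrow> b \<in> carrier G \<Longrightarrow> (a, b) \<in> leq \<or> (b, a) \<in> leq"
  using linear_order leq_refl by (cases "a = b") (auto simp: linear_order_on_def total_on_def)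

end

text \<open>Transport of the order along an injection, as needed to copy a countable ordered group.\<close>

lemma (in totally_ordered_abelian_group) totally_ordered_subgroup_image:
  assumes H: "subgroup H G" and inj: "inj_on \<phi> H"
  shows "totally_ordered_abelian_group (image_group \<phi> (G\<lparr>carrier := H\<rparr>))
    (map_prod \<phi> \<phi> ` (leq \<inter> H \<times> H))"
proof -
  interpret H: comm_group "G\<lparr>carrier := H\<rparr>"
    by (intro group.group_comm_groupI subgroup_imp_group H)
      (use subgroup.mem_carrier[OF H] in \<open>simp add: m_comm\<close>)
  let ?T = "image_group \<phi> (G\<lparr>carrier := H\<rparr>)" and ?le = "map_prod \<phi> \<phi> ` (leq \<inter> H \<times> H)"
  have iso: "\<phi> \<in> iso (G\<lparr>carrier := H\<rparr>) ?T"
    using inj by (intro inj_imp_image_group_iso) simp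
  have "comm_group ?T"
    using H.iso_imp_img_comm_group[OF iso] by (simp add: image_group_def)
  then interpret T: comm_group ?T .
  have car: "carrier ?T = \<phi> ` H"
    by (simp add: image_group_carrier)
  have le: "(\<phi> a, \<phi> b) \<in> ?le \<longleftrightarrow> (a, b) \<in> leq" if "a \<in> H" "b \<in> H" for a b
    using inj that by (auto simp: inj_on_def)
  have HG: "a \<in> carrier G" if "a \<in> H" for a
    using H that by (rule subgroup.mem_carrier)
  show ?thesis
  proof
    show "linear_order_on (carrier ?T) ?le"
      unfolding linear_order_on_def partial_order_on_def preorder_on_def car
    proof (intro conjI)
      show "?le \<subseteq> \<phi> ` H \<times> \<phi> ` H"
        by auto
      show "refl_on (\<phi> ` H) ?le"
        using HG leq_refl by (auto simp: refl_on_def)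
      show "trans ?le"
      proof (rule transI)
        fix x y z assume "(x, y) \<in> ?le" "(y, z) \<in> ?le"
        then obtain a b b' c where "x = \<phi> a" "y = \<phi> b" "a \<in> H" "b \<in> H" "(a, b) \<in> leq"
          and "y = \<phi> b'" "z = \<phi> c" "b' \<in> H" "c \<in> H" "(b', c) \<in> leq"
          by (elim imageE) (auto simp: map_prod_def)
        moreover from this have "b = b'"
          using inj by (metis inj_onD)
        ultimately show "(x, z) \<in> ?le"
          using le leq_trans by metis
      qed
      show "antisym ?le"
      proof (rule antisymI)
        fix x y assume "(x, y) \<in> ?le" "(y, x) \<in> ?le"
        then obtain a b b' a' where "x = \<phi> a" "y = \<phi> b" "a \<in> H" "b \<in> H" "(a, b) \<in> leq"
          and "y = \<phi> b'" "x = \<phi> a'" "a' \<in> H" "b' \<in> H" "(b', a') \<in> leq"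
          by (elim imageE) (auto simp: map_prod_def)
        moreover from this have "a = a'" "b = b'"
          using inj by (metis inj_onD)+
        ultimately show "x = y"
          using leq_antisym by metis
      qed
      show "total_on (\<phi> ` H) ?le"
        using HG leq_total le by (auto simp: total_on_def simp del: map_prod_simp)
    qed
  next
    fix x y z assume xy: "(x, y) \<in> ?le" and z: "z \<in> carrier ?T"
    obtain a b where ab: "x = \<phi> a" "y = \<phi> b" "a \<in> H" "b \<in> H" "(a, b) \<in> leq"
      using xy by auto
    obtain c where c: "z = \<phi> c" "c \<in> H"
      using z car by auto
    have hom: "\<phi> (u \<otimes> c) = \<phi> u \<otimes>\<^bsub>?T\<^esub> \<phi> c" if "u \<in> H" for u
      using iso that c by (auto simp: iso_def hom_def)
    have "(a \<otimes> c, b \<otimes> c) \<in> leq"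
      using mult_le_mono ab c HG by blast
    then have "(\<phi> (a \<otimes> c), \<phi> (b \<otimes> c)) \<in> ?le"
      using le subgroup.m_closed[OF H] ab c by metis
    then show "(x \<otimes>\<^bsub>?T\<^esub> z, y \<otimes>\<^bsub>?T\<^esub> z) \<in> ?le"
      using hom ab c by simp
  qed
qed

lemma max_plus_simps [simp]:
  "carrier (max_plus G leq) = insert None (Some ` carrier G)"
  "\<zero>\<^bsub>max_plus G leq\<^esub> = None"
  "\<one>\<^bsub>max_plus G leq\<^esub> = Some \<one>\<^bsub>G\<^esub>"
  "None \<oplus>\<^bsub>max_plus G leq\<^esub> x = x"
  "x \<oplus>\<^bsub>max_plus G leq\<^esub> None = x"
  "Some a \<oplus>\<^bsub>max_plus G leq\<^esub> Some b = Some (if (a, b) \<in> leq then b else a)"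
  "None \<otimes>\<^bsub>max_plus G leq\<^esub> x = None"
  "x \<otimes>\<^bsub>max_plus G leq\<^esub> None = None"
  "Some a \<otimes>\<^bsub>max_plus G leq\<^esub> Some b = Some (a \<otimes>\<^bsub>G\<^esub> b)"
  by (auto simp: max_plus_def adjoin_bot_def split: option.split)

text \<open>
  The finite values of all positive expressions in the max-plus algebra form a countable submonoid
  \<open>W\<close> of the group, and its quotients \<open>a - b\<close> form a countable subgroup.
\<close>

lemma (in totally_ordered_abelian_group) values_in_countable_subgroup:
  fixes t :: "'v::countable \<Rightarrow> 'a option"
  assumes t: "\<And>v. t v \<in> carrier (max_plus G leq)"
  obtains H where "subgroup H G" "countable H" "\<And>v. t v \<in> insert None (Some ` H)"
proof -
  let ?e = "pos_eval (max_plus G leq) t"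
  define W where "W = {a. Some a \<in> range ?e}"
  define H where "H = (\<lambda>(a, b). a \<otimes> inv b) ` (W \<times> W)"
  have closed: "?e A \<in> carrier (max_plus G leq)" for A
    by (rule pos_eval_rel[of "\<lambda>x _. x \<in> carrier (max_plus G leq)" _ _ t t])
      (use t in auto)
  have WG: "a \<in> carrier G" if "a \<in> W" for a
  proof -
    obtain A where "?e A = Some a"
      using \<open>a \<in> W\<close> by (auto simp: W_def)
    then show ?thesis
      using closed[of A] by auto
  qed
  have W1: "\<one> \<in> W"
    by (auto simp: W_def intro: range_eqI[of _ _ EOne])
  have Wm: "a \<otimes> b \<in> W" if "a \<in> W" "b \<in> W" for a b
  proof -
    obtain A B where "?e A = Some a" "?e B = Some b"
      using \<open>a \<in> W\<close> \<open>b \<in> W\<close> unfolding W_def by auto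
    then show ?thesis
      unfolding W_def by (auto intro!: range_eqI[of _ _ "EMul A B"])
  qed
  have HI: "a \<otimes> inv b \<in> H" if "a \<in> W" "b \<in> W" for a b
    using that by (force simp: H_def)
  have "subgroup H G"
  proof (rule subgroupI)
    show "H \<subseteq> carrier G"
      using WG by (auto simp: H_def)
    show "H \<noteq> {}"
      using HI W1 by blast
  next
    fix x assume "x \<in> H"
    then obtain a b where ab: "x = a \<otimes> inv b" "a \<in> W" "b \<in> W"
      by (auto simp: H_def)
    have "inv x = b \<otimes> inv a"
      using ab WG by (simp add: inv_mult_group)
    then show "inv x \<in> H"
      using HI ab by simp
  next
    fix x y assume "x \<in> H" "y \<in> H"
    then obtain a b c d where ab: "x = a \<otimes> inv b" "y = c \<otimes> inv d" "a \<in> W" "b \<in> W" "c \<in> W" "d \<in> W"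
      by (auto simp: H_def)
    have "x \<otimes> y = (a \<otimes> c) \<otimes> inv (b \<otimes> d)"
      using ab WG by (simp add: inv_mult_group m_ac)
    then show "x \<otimes> y \<in> H"
      using HI Wm ab by simp
  qed
  moreover have "countable H"
  proof -
    have "countable (Some ` W)"
      by (rule countable_subset[of _ "range ?e"]) (auto simp: W_def)
    then have "countable W"
      by (rule countable_image_inj_on) simp
    then show ?thesis
      by (simp add: H_def)
  qed
  moreover have "t v \<in> insert None (Some ` H)" for v
  proof (cases "t v")
    case (Some a)
    have "a \<in> W"
      unfolding W_def using Some by (auto intro!: range_eqI[of _ _ "EVar v"])
    then have "a \<in> H"
      using HI[of a \<one>] W1 WG by simp
    then show ?thesis
      using Some by simp
  qed simp
  ultimately show ?thesis
    by (rule that)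
qed

text \<open>
  The variables and all values stay in a countable subgroup, which has an ordered copy in the
  universe type.
\<close>

lemma tropical_inequality_everywhere:
  fixes F :: "('f, 'c) monoid_scheme"
  assumes ineq: "\<And>(G :: ('u :: infinite) monoid) leq. totally_ordered_abelian_group G leq \<Longrightarrow>
      identity_holds m (max_plus G leq) (\<lambda>a. a) (max_plus_ge leq) P Q"
    and "totally_ordered_abelian_group F leq" and t: "\<And>v. t v \<in> carrier (max_plus F leq)"
  shows "max_plus_ge leq (poly_eval (max_plus F leq) (\<lambda>a. a) t P) (poly_eval (max_plus F leq) (\<lambda>a. a) t Q)"
proof -
  interpret totally_ordered_abelian_group F leq by fact
  obtain H where H: "subgroup H F" "countable H" and tH: "\<And>v. t v \<in> insert None (Some ` H)"
    using values_in_countable_subgroup[of t, OF t] by metis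
  obtain \<phi> :: "'f \<Rightarrow> 'u" where inj: "inj_on \<phi> H"
    using H(2) by (rule inj_on_countable_into_infinite)
  define G where "G = image_group \<phi> (F\<lparr>carrier := H\<rparr>)"
  define le where "le = map_prod \<phi> \<phi> ` (leq \<inter> H \<times> H)"
  have tog: "totally_ordered_abelian_group G le"
    unfolding G_def le_def using H(1) inj by (rule totally_ordered_subgroup_image)
  have le: "(\<phi> a, \<phi> b) \<in> le \<longleftrightarrow> (a, b) \<in> leq" if "a \<in> H" "b \<in> H" for a b
    using inj that by (auto simp: le_def inj_on_def)
  have mult: "\<phi> a \<otimes>\<^bsub>G\<^esub> \<phi> b = \<phi> (a \<otimes>\<^bsub>F\<^esub> b)" if "a \<in> H" "b \<in> H" for a b
    using inj that by (simp add: G_def image_group_def)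
  have one: "\<one>\<^bsub>G\<^esub> = \<phi> \<one>\<^bsub>F\<^esub>"
    by (simp add: G_def image_group_def)
  let ?t' = "map_option \<phi> \<circ> t" and ?ev = "poly_eval (max_plus F leq) (\<lambda>a. a) t"
  have ev: "?ev X \<in> insert None (Some ` H) \<and>
      poly_eval (max_plus G le) (\<lambda>a. a) ?t' X = map_option \<phi> (?ev X)" for X
    by (rule poly_eval_rel[of "\<lambda>x y. x \<in> insert None (Some ` H) \<and> y = map_option \<phi> x"])
      (use tH H(1) in \<open>auto simp: le mult one subgroup.one_closed intro: subgroup.m_closed\<close>)
  have "?t' v \<in> carrier (max_plus G le)" for v
    using tH[of v] by (auto simp: G_def image_group_carrier)
  then have "max_plus_ge le (map_option \<phi> (?ev P)) (map_option \<phi> (?ev Q))"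
    using ineq[OF tog] ev[of P] ev[of Q] unfolding identity_holds_def by metis
  then show ?thesis
    using ev[of P] ev[of Q] by (auto simp: le)
qed


section \<open>The endomorphism ring of an abelian group\<close>

text \<open>
  The group is written multiplicatively, so the sum of two endomorphisms is their pointwise product.
  Endomorphisms are made extensional so that the ring axioms hold as equations between functions.
\<close>

definition endomorphism_ring :: "('a, 'b) monoid_scheme \<Rightarrow> ('a \<Rightarrow> 'a) ring" where
  "endomorphism_ring M =
    \<lparr>carrier = hom M M \<inter> extensional (carrier M),
     mult = compose (carrier M),
     one = \<lambda>x\<in>carrier M. x,
     zero = \<lambda>x\<in>carrier M. \<one>\<^bsub>M\<^esub>,
     add = \<lambda>\<phi> \<psi>. \<lambda>x\<in>carrier M. \<phi> x \<otimes>\<^bsub>M\<^esub> \<psi> x\<rparr>"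

lemma endomorphism_ring_simps [simp]:
  "\<phi> \<in> carrier (endomorphism_ring M) \<longleftrightarrow> \<phi> \<in> hom M M \<and> \<phi> \<in> extensional (carrier M)"
  "\<phi> \<otimes>\<^bsub>endomorphism_ring M\<^esub> \<psi> = compose (carrier M) \<phi> \<psi>"
  "\<one>\<^bsub>endomorphism_ring M\<^esub> = (\<lambda>x\<in>carrier M. x)"
  "\<zero>\<^bsub>endomorphism_ring M\<^esub> = (\<lambda>x\<in>carrier M. \<one>\<^bsub>M\<^esub>)"
  "\<phi> \<oplus>\<^bsub>endomorphism_ring M\<^esub> \<psi> = (\<lambda>x\<in>carrier M. \<phi> x \<otimes>\<^bsub>M\<^esub> \<psi> x)"
  by (simp_all add: endomorphism_ring_def)

context comm_group
begin

lemma endomorphism_inverse: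
  assumes "\<phi> \<in> hom G G"
  shows "(\<lambda>x\<in>carrier G. inv (\<phi> x)) \<in> hom G G"
  using assms by (auto simp: hom_def Pi_iff inv_mult_group m_comm)

lemma ring_endomorphism_ring: "ring (endomorphism_ring G)"
proof (intro ringI abelian_groupI monoidI)
  let ?E = "endomorphism_ring G"
  have closed [simp]: "\<phi> x \<in> carrier G" if "\<phi> \<in> hom G G" "x \<in> carrier G" for \<phi> x
    using that by (rule hom_in_carrier)
  have mult [simp]: "\<phi> (x \<otimes> y) = \<phi> x \<otimes> \<phi> y"
    if "\<phi> \<in> hom G G" "x \<in> carrier G" "y \<in> carrier G" for \<phi> x y
    using that by (rule hom_mult)
  have one [simp]: "\<phi> \<one> = \<one>" if "\<phi> \<in> hom G G" for \<phi>
    using hom_one[OF that] is_group by simp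
  have eqI: "\<phi> = \<psi>" if "\<And>x. x \<in> carrier G \<Longrightarrow> \<phi> x = \<psi> x"
    "\<phi> \<in> extensional (carrier G)" "\<psi> \<in> extensional (carrier G)" for \<phi> \<psi> :: "'a \<Rightarrow> 'a"
    using that(2,3,1) by (rule extensionalityI)
  note [simp] = compose_eq
  show "\<zero>\<^bsub>?E\<^esub> \<in> carrier ?E" "\<one>\<^bsub>?E\<^esub> \<in> carrier ?E"
    by (auto intro!: homI)
  fix \<phi> assume \<phi>: "\<phi> \<in> carrier ?E"
  show "\<one>\<^bsub>?E\<^esub> \<otimes>\<^bsub>?E\<^esub> \<phi> = \<phi>" "\<phi> \<otimes>\<^bsub>?E\<^esub> \<one>\<^bsub>?E\<^esub> = \<phi>" "\<zero>\<^bsub>?E\<^esub> \<oplus>\<^bsub>?E\<^esub> \<phi> = \<phi>"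
    by (rule eqI; use \<phi> in simp)+
  have "(\<lambda>x\<in>carrier G. inv (\<phi> x)) \<oplus>\<^bsub>?E\<^esub> \<phi> = \<zero>\<^bsub>?E\<^esub>"
    by (rule eqI; use \<phi> in simp)
  then show "\<exists>\<psi>\<in>carrier ?E. \<psi> \<oplus>\<^bsub>?E\<^esub> \<phi> = \<zero>\<^bsub>?E\<^esub>"
    using \<phi> endomorphism_inverse[of \<phi>]
    by (intro bexI[of _ "\<lambda>x\<in>carrier G. inv (\<phi> x)"]) auto
  fix \<psi> assume \<psi>: "\<psi> \<in> carrier ?E"
  show "\<phi> \<oplus>\<^bsub>?E\<^esub> \<psi> = \<psi> \<oplus>\<^bsub>?E\<^esub> \<phi>"
    by (rule eqI; use \<phi> \<psi> in \<open>simp add: m_comm\<close>)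
  show "\<phi> \<oplus>\<^bsub>?E\<^esub> \<psi> \<in> carrier ?E" "\<phi> \<otimes>\<^bsub>?E\<^esub> \<psi> \<in> carrier ?E"
    using \<phi> \<psi> by (auto intro!: homI simp: m_ac)
  fix \<chi> assume \<chi>: "\<chi> \<in> carrier ?E"
  show "\<phi> \<oplus>\<^bsub>?E\<^esub> \<psi> \<oplus>\<^bsub>?E\<^esub> \<chi> = \<phi> \<oplus>\<^bsub>?E\<^esub> (\<psi> \<oplus>\<^bsub>?E\<^esub> \<chi>)"
    "\<phi> \<otimes>\<^bsub>?E\<^esub> \<psi> \<otimes>\<^bsub>?E\<^esub> \<chi> = \<phi> \<otimes>\<^bsub>?E\<^esub> (\<psi> \<otimes>\<^bsub>?E\<^esub> \<chi>)"
    "(\<phi> \<oplus>\<^bsub>?E\<^esub> \<psi>) \<otimes>\<^bsub>?E\<^esub> \<chi> = \<phi> \<otimes>\<^bsub>?E\<^esub> \<chi> \<oplus>\<^bsub>?E\<^esub> \<psi> \<otimes>\<^bsub>?E\<^esub> \<chi>"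
    "\<chi> \<otimes>\<^bsub>?E\<^esub> (\<phi> \<oplus>\<^bsub>?E\<^esub> \<psi>) = \<chi> \<otimes>\<^bsub>?E\<^esub> \<phi> \<oplus>\<^bsub>?E\<^esub> \<chi> \<otimes>\<^bsub>?E\<^esub> \<psi>"
    by (rule eqI; use \<phi> \<psi> \<chi> in \<open>simp add: m_assoc\<close>)+
qed

lemma endomorphism_ring_a_inv:
  assumes "\<phi> \<in> carrier (endomorphism_ring G)"
  shows "\<ominus>\<^bsub>endomorphism_ring G\<^esub> \<phi> = (\<lambda>x\<in>carrier G. inv (\<phi> x))"
proof -
  interpret E: ring "endomorphism_ring G"
    by (rule ring_endomorphism_ring)
  show ?thesis
    by (rule E.minus_equality) (use assms endomorphism_inverse in \<open>auto simp: hom_def Pi_iff intro!: restrict_ext\<close>)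
qed

end

section \<open>Leading terms of weighted shift operators\<close>

lemma elt_ring_simps [simp]:
  "carrier (elt_ring L F leq) = insert None (Some ` (carrier L \<times> carrier F))"
  "\<zero>\<^bsub>elt_ring L F leq\<^esub> = None"
  "\<one>\<^bsub>elt_ring L F leq\<^esub> = Some (\<one>\<^bsub>L\<^esub>, \<one>\<^bsub>F\<^esub>)"
  "None \<oplus>\<^bsub>elt_ring L F leq\<^esub> x = x"
  "x \<oplus>\<^bsub>elt_ring L F leq\<^esub> None = x"
  "Some u \<oplus>\<^bsub>elt_ring L F leq\<^esub> Some v = Some (elt_add L leq u v)"
  "None \<otimes>\<^bsub>elt_ring L F leq\<^esub> x = None"
  "x \<otimes>\<^bsub>elt_ring L F leq\<^esub> None = None"
  "Some u \<otimes>\<^bsub>elt_ring L F leq\<^esub> Some v = Some (elt_mult L F u v)"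
  by (auto simp: elt_ring_def adjoin_bot_def split: option.split)

locale elt_ring_data = L: cring L + F: totally_ordered_abelian_group F leq
  for L :: "('l, 'b) ring_scheme" and F :: "('f, 'c) monoid_scheme" and leq
begin

lemma elt_neg_simps [simp]:
  "elt_neg L F leq None = None"
  "l \<in> carrier L \<Longrightarrow> a \<in> carrier F \<Longrightarrow> elt_neg L F leq (Some (l, a)) = Some (\<ominus>\<^bsub>L\<^esub> l, a)"
  by (simp_all add: elt_neg_def L.l_minus)

text \<open>
  Forgetting layers is a homomorphism from the ELT ring to the max-plus algebra, and it turns the
  negation map into the trivial one.
\<close>

lemma poly_eval_elt_ring:
  assumes "\<And>v. r v \<in> carrier (elt_ring L F leq)"
  shows "poly_eval (elt_ring L F leq) (elt_neg L F leq) r X \<in> carrier (elt_ring L F leq) \<and>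
    poly_eval (max_plus F leq) (\<lambda>a. a) (map_option snd \<circ> r) X =
      map_option snd (poly_eval (elt_ring L F leq) (elt_neg L F leq) r X)"
proof (rule poly_eval_rel[of "\<lambda>x y. x \<in> carrier (elt_ring L F leq) \<and> y = map_option snd x"])
  fix x x' y y'
  assume "x \<in> carrier (elt_ring L F leq) \<and> x' = map_option snd x"
    and "y \<in> carrier (elt_ring L F leq) \<and> y' = map_option snd y"
  then show "x \<oplus>\<^bsub>elt_ring L F leq\<^esub> y \<in> carrier (elt_ring L F leq) \<and>
      x' \<oplus>\<^bsub>max_plus F leq\<^esub> y' = map_option snd (x \<oplus>\<^bsub>elt_ring L F leq\<^esub> y)"
    using F.leq_antisym by (auto dest: F.leq_total)
qed (use assms in auto)

abbreviation fun_group :: "('f \<Rightarrow> 'l) monoid" where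
  "fun_group \<equiv> product_group (carrier F) (\<lambda>_. add_monoid L)"

lemma fun_closed [simp]:
  assumes "f \<in> carrier F \<rightarrow>\<^sub>E carrier L" "x \<in> carrier F"
  shows "f x \<in> carrier L"
  using assms by (rule PiE_mem)

lemma comm_group_fun_group: "comm_group fun_group"
  by (rule group.group_comm_groupI) (auto simp: L.a_comm intro!: restrict_ext)

interpretation M: comm_group fun_group
  by (rule comm_group_fun_group)

abbreviation operators :: "(('f \<Rightarrow> 'l) \<Rightarrow> 'f \<Rightarrow> 'l) ring" where
  "operators \<equiv> endomorphism_ring fun_group"

lemma operator_closed:
  assumes "\<phi> \<in> carrier operators" "f \<in> carrier fun_group"
  shows "\<phi> f \<in> carrier fun_group"
  using assms by (auto simp only: endomorphism_ring_simps hom_def Pi_iff mem_Collect_eq)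

lemma operator_uminus_apply:
  assumes "\<phi> \<in> carrier operators" "f \<in> carrier fun_group" "x \<in> carrier F"
  shows "(\<ominus>\<^bsub>operators\<^esub> \<phi>) f x = \<ominus>\<^bsub>L\<^esub> \<phi> f x"
  using operator_closed[OF assms(1,2)] assms(2,3)
  unfolding M.endomorphism_ring_a_inv[OF assms(1)] by (simp add: a_inv_def)

fun weighted_shift :: "('l \<times> 'f) option \<Rightarrow> ('f \<Rightarrow> 'l) \<Rightarrow> 'f \<Rightarrow> 'l" where
  "weighted_shift None = \<zero>\<^bsub>operators\<^esub>"
| "weighted_shift (Some (l, a)) =
    (\<lambda>f\<in>carrier fun_group. \<lambda>x\<in>carrier F. l \<otimes>\<^bsub>L\<^esub> f (inv\<^bsub>F\<^esub> a \<otimes>\<^bsub>F\<^esub> x))"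

lemma weighted_shift_closed:
  assumes "u \<in> carrier (elt_ring L F leq)"
  shows "weighted_shift u \<in> carrier operators"
proof (cases u)
  case None
  then show ?thesis
    using ring.ring_simprules(2)[OF M.ring_endomorphism_ring] by simp
next
  case (Some p)
  then obtain l a where u: "u = Some (l, a)" and la: "l \<in> carrier L" "a \<in> carrier F"
    using assms by auto
  show ?thesis
    unfolding u using la
    by (auto simp: hom_def L.r_distr intro!: restrict_ext)
qed

lemma weighted_shifts_commute:
  assumes "u \<in> carrier (elt_ring L F leq)" "v \<in> carrier (elt_ring L F leq)"
  shows "weighted_shift u \<otimes>\<^bsub>operators\<^esub> weighted_shift v = weighted_shift v \<otimes>\<^bsub>operators\<^esub> weighted_shift u"
proof (cases "u = None \<or> v = None")
  case True
  interpret E: ring operators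
    by (rule M.ring_endomorphism_ring)
  show ?thesis
    using True weighted_shift_closed[OF assms(1)] weighted_shift_closed[OF assms(2)]
    by (auto simp del: endomorphism_ring_simps)
next
  case False
  then obtain l a k b where u: "u = Some (l, a)" and v: "v = Some (k, b)"
    and la: "l \<in> carrier L" "a \<in> carrier F" and kb: "k \<in> carrier L" "b \<in> carrier F"
    using assms by auto
  have "l \<otimes>\<^bsub>L\<^esub> (k \<otimes>\<^bsub>L\<^esub> f (inv\<^bsub>F\<^esub> b \<otimes>\<^bsub>F\<^esub> (inv\<^bsub>F\<^esub> a \<otimes>\<^bsub>F\<^esub> x))) =
      k \<otimes>\<^bsub>L\<^esub> (l \<otimes>\<^bsub>L\<^esub> f (inv\<^bsub>F\<^esub> a \<otimes>\<^bsub>F\<^esub> (inv\<^bsub>F\<^esub> b \<otimes>\<^bsub>F\<^esub> x)))"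
    if "f \<in> carrier F \<rightarrow>\<^sub>E carrier L" "x \<in> carrier F" for f x
    using that la kb by (simp add: L.m_lcomm F.m_lcomm)
  then show ?thesis
    unfolding u v using la kb
    by (auto simp: compose_def intro!: restrict_ext)
qed

definition vanishes_above :: "'f \<Rightarrow> ('f \<Rightarrow> 'l) \<Rightarrow> bool" where
  "vanishes_above s f \<longleftrightarrow> (\<forall>x\<in>carrier F. (s, x) \<in> leq \<longrightarrow> x \<noteq> s \<longrightarrow> f x = \<zero>\<^bsub>L\<^esub>)"

text \<open>
  The layer \<open>l\<close> may be zero, so \<open>a\<close> is only an upper bound for the exponents that occur in \<open>\<phi>\<close>, and
  \<open>\<phi>\<close> may have several leading terms. Quantifying over all \<open>f\<close> and \<open>s\<close>, not only over the delta function,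
  is what makes the notion stable under composition.
\<close>

definition has_leading_term :: "('l \<times> 'f) option \<Rightarrow> (('f \<Rightarrow> 'l) \<Rightarrow> 'f \<Rightarrow> 'l) \<Rightarrow> bool" where
  "has_leading_term u \<phi> \<longleftrightarrow> u \<in> carrier (elt_ring L F leq) \<and> \<phi> \<in> carrier operators \<and>
    (case u of
       None \<Rightarrow> \<phi> = \<zero>\<^bsub>operators\<^esub>
     | Some (l, a) \<Rightarrow> \<forall>f\<in>carrier fun_group. \<forall>s\<in>carrier F. vanishes_above s f \<longrightarrow>
         vanishes_above (a \<otimes>\<^bsub>F\<^esub> s) (\<phi> f) \<and> \<phi> f (a \<otimes>\<^bsub>F\<^esub> s) = l \<otimes>\<^bsub>L\<^esub> f s)"

lemma has_leading_term_None [simp]: "has_leading_term None \<phi> \<longleftrightarrow> \<phi> = \<zero>\<^bsub>operators\<^esub>"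
  using ring.ring_simprules(2)[OF M.ring_endomorphism_ring] by (auto simp: has_leading_term_def)

lemma has_leading_term_SomeI:
  assumes "l \<in> carrier L" "a \<in> carrier F" "\<phi> \<in> carrier operators"
    and "\<And>f s x. f \<in> carrier fun_group \<Longrightarrow> s \<in> carrier F \<Longrightarrow> vanishes_above s f \<Longrightarrow>
      x \<in> carrier F \<Longrightarrow> (a \<otimes>\<^bsub>F\<^esub> s, x) \<in> leq \<Longrightarrow> x \<noteq> a \<otimes>\<^bsub>F\<^esub> s \<Longrightarrow> \<phi> f x = \<zero>\<^bsub>L\<^esub>"
    and "\<And>f s. f \<in> carrier fun_group \<Longrightarrow> s \<in> carrier F \<Longrightarrow> vanishes_above s f \<Longrightarrow>
      \<phi> f (a \<otimes>\<^bsub>F\<^esub> s) = l \<otimes>\<^bsub>L\<^esub> f s"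
  shows "has_leading_term (Some (l, a)) \<phi>"
proof -
  have "vanishes_above (a \<otimes>\<^bsub>F\<^esub> s) (\<phi> f)"
    if "f \<in> carrier fun_group" "s \<in> carrier F" "vanishes_above s f" for f s
    unfolding vanishes_above_def using assms(4) that by blast
  then show ?thesis
    using assms(1-3,5) unfolding has_leading_term_def by simp
qed

lemma has_leading_term_SomeD:
  assumes "has_leading_term (Some (l, a)) \<phi>"
  shows "l \<in> carrier L" "a \<in> carrier F" "\<phi> \<in> carrier operators"
    and "\<And>f s x. f \<in> carrier fun_group \<Longrightarrow> s \<in> carrier F \<Longrightarrow> vanishes_above s f \<Longrightarrow>
      x \<in> carrier F \<Longrightarrow> (a \<otimes>\<^bsub>F\<^esub> s, x) \<in> leq \<Longrightarrow> x \<noteq> a \<otimes>\<^bsub>F\<^esub> s \<Longrightarrow> \<phi> f x = \<zero>\<^bsub>L\<^esub>"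
    and "\<And>f s. f \<in> carrier fun_group \<Longrightarrow> s \<in> carrier F \<Longrightarrow> vanishes_above s f \<Longrightarrow>
      \<phi> f (a \<otimes>\<^bsub>F\<^esub> s) = l \<otimes>\<^bsub>L\<^esub> f s"
proof -
  have step: "vanishes_above (a \<otimes>\<^bsub>F\<^esub> s) (\<phi> f) \<and> \<phi> f (a \<otimes>\<^bsub>F\<^esub> s) = l \<otimes>\<^bsub>L\<^esub> f s"
    if "f \<in> carrier fun_group" "s \<in> carrier F" "vanishes_above s f" for f s
    using assms that unfolding has_leading_term_def by simp
  show "\<phi> f x = \<zero>\<^bsub>L\<^esub>" if "f \<in> carrier fun_group" "s \<in> carrier F" "vanishes_above s f"
    "x \<in> carrier F" "(a \<otimes>\<^bsub>F\<^esub> s, x) \<in> leq" "x \<noteq> a \<otimes>\<^bsub>F\<^esub> s" for f s x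
    using step[OF that(1-3)] that(4-6) by (simp add: vanishes_above_def)
  show "\<phi> f (a \<otimes>\<^bsub>F\<^esub> s) = l \<otimes>\<^bsub>L\<^esub> f s"
    if "f \<in> carrier fun_group" "s \<in> carrier F" "vanishes_above s f" for f s
    using step[OF that] by simp
qed (use assms in \<open>auto simp: has_leading_term_def\<close>)

lemma has_leading_term_closed: "has_leading_term u \<phi> \<Longrightarrow> \<phi> \<in> carrier operators"
  by (simp add: has_leading_term_def)

lemma less_mult_left:
  assumes "(a, b) \<in> leq" "a \<noteq> b" "s \<in> carrier F"
  shows "(a \<otimes>\<^bsub>F\<^esub> s, b \<otimes>\<^bsub>F\<^esub> s) \<in> leq" "a \<otimes>\<^bsub>F\<^esub> s \<noteq> b \<otimes>\<^bsub>F\<^esub> s"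
  using assms F.mult_le_mono F.leq_carrier by auto

lemma has_leading_term_weighted_shift:
  assumes "u \<in> carrier (elt_ring L F leq)"
  shows "has_leading_term u (weighted_shift u)"
proof (cases u)
  case (Some p)
  then obtain l a where u: "u = Some (l, a)" and la: "l \<in> carrier L" "a \<in> carrier F"
    using assms by auto
  show ?thesis
    unfolding u
  proof (rule has_leading_term_SomeI)
    fix f s x
    assume f: "f \<in> carrier fun_group" "vanishes_above s f" and s: "s \<in> carrier F" and x: "x \<in> carrier F"
      and less: "(a \<otimes>\<^bsub>F\<^esub> s, x) \<in> leq" "x \<noteq> a \<otimes>\<^bsub>F\<^esub> s"
    have "(s, inv\<^bsub>F\<^esub> a \<otimes>\<^bsub>F\<^esub> x) \<in> leq" "inv\<^bsub>F\<^esub> a \<otimes>\<^bsub>F\<^esub> x \<noteq> s"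
      using less_mult_left[OF less(1) less(2)[symmetric], of "inv\<^bsub>F\<^esub> a"] la s x
      by (simp_all add: F.m_comm[of _ "inv\<^bsub>F\<^esub> a"] flip: F.m_assoc)
    then have "f (inv\<^bsub>F\<^esub> a \<otimes>\<^bsub>F\<^esub> x) = \<zero>\<^bsub>L\<^esub>"
      using f(2) la x by (auto simp: vanishes_above_def)
    then show "weighted_shift (Some (l, a)) f x = \<zero>\<^bsub>L\<^esub>"
      using f la x by simp
  next
    fix f s assume "f \<in> carrier fun_group" "s \<in> carrier F"
    then show "weighted_shift (Some (l, a)) f (a \<otimes>\<^bsub>F\<^esub> s) = l \<otimes>\<^bsub>L\<^esub> f s"
      using la by (simp flip: F.m_assoc)
  qed (use la weighted_shift_closed[OF assms] u in auto)
qed simp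

lemma has_leading_term_one: "has_leading_term (Some (\<one>\<^bsub>L\<^esub>, \<one>\<^bsub>F\<^esub>)) \<one>\<^bsub>operators\<^esub>"
  by (rule has_leading_term_SomeI)
    (use ring.ring_simprules(6)[OF M.ring_endomorphism_ring] in \<open>auto simp: vanishes_above_def\<close>)

text \<open>
  The smaller summand maps a function vanishing above \<open>s\<close> to one vanishing above \<open>b + s\<close>, hence also
  at \<open>a + s\<close> and beyond.
\<close>

lemma has_leading_term_add_greater:
  assumes u: "has_leading_term (Some (l, a)) \<phi>" and v: "has_leading_term (Some (k, b)) \<psi>"
    and less: "(b, a) \<in> leq" "b \<noteq> a"
  shows "has_leading_term (Some (l, a)) (\<phi> \<oplus>\<^bsub>operators\<^esub> \<psi>)"
proof (rule has_leading_term_SomeI)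
  interpret E: ring operators
    by (rule M.ring_endomorphism_ring)
  note U = has_leading_term_SomeD[OF u] and V = has_leading_term_SomeD[OF v]
  show "\<phi> \<oplus>\<^bsub>operators\<^esub> \<psi> \<in> carrier operators"
    using U(3) V(3) by (rule E.add.m_closed)
  fix f s assume f: "f \<in> carrier fun_group" "s \<in> carrier F" "vanishes_above s f"
  note less' = less_mult_left[OF less f(2)]
  have "\<psi> f (a \<otimes>\<^bsub>F\<^esub> s) = \<zero>\<^bsub>L\<^esub>"
    using V(4)[OF f, of "a \<otimes>\<^bsub>F\<^esub> s"] less' U(2) f(2) by auto
  then show "(\<phi> \<oplus>\<^bsub>operators\<^esub> \<psi>) f (a \<otimes>\<^bsub>F\<^esub> s) = l \<otimes>\<^bsub>L\<^esub> f s"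
    using U(1,2,5) f by simp
  fix x assume x: "x \<in> carrier F" "(a \<otimes>\<^bsub>F\<^esub> s, x) \<in> leq" "x \<noteq> a \<otimes>\<^bsub>F\<^esub> s"
  have "(b \<otimes>\<^bsub>F\<^esub> s, x) \<in> leq" "x \<noteq> b \<otimes>\<^bsub>F\<^esub> s"
    using less' x F.leq_trans F.leq_antisym by blast+
  then show "(\<phi> \<oplus>\<^bsub>operators\<^esub> \<psi>) f x = \<zero>\<^bsub>L\<^esub>"
    using U(4)[OF f x] V(4)[OF f x(1)] f x by simp
qed (fact has_leading_term_SomeD(1,2)[OF u])+

lemma has_leading_term_add_equal:
  assumes u: "has_leading_term (Some (l, a)) \<phi>" and v: "has_leading_term (Some (k, a)) \<psi>"
  shows "has_leading_term (Some (l \<oplus>\<^bsub>L\<^esub> k, a)) (\<phi> \<oplus>\<^bsub>operators\<^esub> \<psi>)"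
proof (rule has_leading_term_SomeI)
  interpret E: ring operators
    by (rule M.ring_endomorphism_ring)
  note U = has_leading_term_SomeD[OF u] and V = has_leading_term_SomeD[OF v]
  show "\<phi> \<oplus>\<^bsub>operators\<^esub> \<psi> \<in> carrier operators"
    using U(3) V(3) by (rule E.add.m_closed)
  fix f s assume f: "f \<in> carrier fun_group" "s \<in> carrier F" "vanishes_above s f"
  show "(\<phi> \<oplus>\<^bsub>operators\<^esub> \<psi>) f (a \<otimes>\<^bsub>F\<^esub> s) = (l \<oplus>\<^bsub>L\<^esub> k) \<otimes>\<^bsub>L\<^esub> f s"
    using U(1,2) U(5)[OF f] V(1) V(5)[OF f] f by (simp add: L.l_distr)
  fix x assume x: "x \<in> carrier F" "(a \<otimes>\<^bsub>F\<^esub> s, x) \<in> leq" "x \<noteq> a \<otimes>\<^bsub>F\<^esub> s"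
  then show "(\<phi> \<oplus>\<^bsub>operators\<^esub> \<psi>) f x = \<zero>\<^bsub>L\<^esub>"
    using U(4)[OF f x] V(4)[OF f x] f by simp
qed (use has_leading_term_SomeD(1,2)[OF u] has_leading_term_SomeD(1)[OF v] in auto)

lemma has_leading_term_add:
  assumes u: "has_leading_term u \<phi>" and v: "has_leading_term v \<psi>"
  shows "has_leading_term (u \<oplus>\<^bsub>elt_ring L F leq\<^esub> v) (\<phi> \<oplus>\<^bsub>operators\<^esub> \<psi>)"
proof -
  interpret E: ring operators
    by (rule M.ring_endomorphism_ring)
  have closed: "\<phi> \<in> carrier operators" "\<psi> \<in> carrier operators"
    using u v by (auto dest: has_leading_term_closed)
  show ?thesis
  proof (cases "u = None \<or> v = None")
    case True
    then show ?thesis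
      using u v closed by (auto simp del: endomorphism_ring_simps)
  next
    case False
    then obtain l a k b where uv: "u = Some (l, a)" "v = Some (k, b)"
      by auto
    have ab: "a \<in> carrier F" "b \<in> carrier F"
      using u v has_leading_term_SomeD(2) unfolding uv by blast+
    consider "a = b" | "(b, a) \<in> leq" "b \<noteq> a" | "(a, b) \<in> leq" "a \<noteq> b" "(b, a) \<notin> leq"
      using F.leq_total[OF ab] F.leq_antisym by blast
    then show ?thesis
    proof cases
      case 1
      then show ?thesis
        using has_leading_term_add_equal u v unfolding uv by simp
    next
      case 2
      then show ?thesis
        using has_leading_term_add_greater[of l a \<phi> k b \<psi>] u v unfolding uv by simp
    next
      case 3
      then show ?thesis
        using has_leading_term_add_greater[of k b \<psi> l a \<phi>] u v E.a_comm[OF closed]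
        unfolding uv by simp
    qed
  qed
qed

lemma has_leading_term_mult:
  assumes u: "has_leading_term u \<phi>" and v: "has_leading_term v \<psi>"
  shows "has_leading_term (u \<otimes>\<^bsub>elt_ring L F leq\<^esub> v) (\<phi> \<otimes>\<^bsub>operators\<^esub> \<psi>)"
proof -
  interpret E: ring operators
    by (rule M.ring_endomorphism_ring)
  have closed: "\<phi> \<in> carrier operators" "\<psi> \<in> carrier operators"
    using u v by (auto dest: has_leading_term_closed)
  show ?thesis
  proof (cases "u = None \<or> v = None")
    case True
    then show ?thesis
      using u v closed by (auto simp del: endomorphism_ring_simps)
  next
    case False
    then obtain l a k b where uv: "u = Some (l, a)" "v = Some (k, b)"
      by auto
    note U = has_leading_term_SomeD[OF u[unfolded uv]] and V = has_leading_term_SomeD[OF v[unfolded uv]]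
    have "has_leading_term (Some (l \<otimes>\<^bsub>L\<^esub> k, a \<otimes>\<^bsub>F\<^esub> b)) (\<phi> \<otimes>\<^bsub>operators\<^esub> \<psi>)"
    proof (rule has_leading_term_SomeI)
      show "\<phi> \<otimes>\<^bsub>operators\<^esub> \<psi> \<in> carrier operators"
        using closed by (rule E.m_closed)
      fix f s assume f: "f \<in> carrier fun_group" "s \<in> carrier F" "vanishes_above s f"
      have app: "(\<phi> \<otimes>\<^bsub>operators\<^esub> \<psi>) f = \<phi> (\<psi> f)"
        using f(1) by (simp add: compose_eq)
      have g: "\<psi> f \<in> carrier fun_group" "b \<otimes>\<^bsub>F\<^esub> s \<in> carrier F" "vanishes_above (b \<otimes>\<^bsub>F\<^esub> s) (\<psi> f)"
        using operator_closed[OF closed(2) f(1)] V(2) f(2) V(4)[OF f] by (auto simp: vanishes_above_def)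
      have assoc: "a \<otimes>\<^bsub>F\<^esub> b \<otimes>\<^bsub>F\<^esub> s = a \<otimes>\<^bsub>F\<^esub> (b \<otimes>\<^bsub>F\<^esub> s)"
        using U(2) V(2) f(2) by (rule F.m_assoc)
      show "(\<phi> \<otimes>\<^bsub>operators\<^esub> \<psi>) f (a \<otimes>\<^bsub>F\<^esub> b \<otimes>\<^bsub>F\<^esub> s) = l \<otimes>\<^bsub>L\<^esub> k \<otimes>\<^bsub>L\<^esub> f s"
        using U(5)[OF g] V(5)[OF f] U(1) V(1) f(1,2) unfolding app assoc by (simp add: L.m_assoc)
      show "(\<phi> \<otimes>\<^bsub>operators\<^esub> \<psi>) f x = \<zero>\<^bsub>L\<^esub>"
        if "x \<in> carrier F" "(a \<otimes>\<^bsub>F\<^esub> b \<otimes>\<^bsub>F\<^esub> s, x) \<in> leq" "x \<noteq> a \<otimes>\<^bsub>F\<^esub> b \<otimes>\<^bsub>F\<^esub> s" for x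
        using U(4)[OF g] that unfolding app assoc by blast
    qed (use U(1,2) V(1,2) in auto)
    then show ?thesis
      unfolding uv by simp
  qed
qed

lemma has_leading_term_uminus:
  assumes u: "has_leading_term u \<phi>"
  shows "has_leading_term (elt_neg L F leq u) (\<ominus>\<^bsub>operators\<^esub> \<phi>)"
proof -
  interpret E: ring operators
    by (rule M.ring_endomorphism_ring)
  show ?thesis
  proof (cases u)
    case None
    then show ?thesis
      using u by (simp del: endomorphism_ring_simps)
  next
    case (Some p)
    then obtain l a where p: "u = Some (l, a)"
      by (cases p) auto
    note U = has_leading_term_SomeD[OF u[unfolded p]]
    have "has_leading_term (Some (\<ominus>\<^bsub>L\<^esub> l, a)) (\<ominus>\<^bsub>operators\<^esub> \<phi>)"
    proof (rule has_leading_term_SomeI)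
      show "\<ominus>\<^bsub>operators\<^esub> \<phi> \<in> carrier operators"
        using U(3) by (rule E.a_inv_closed)
      fix f s assume f: "f \<in> carrier fun_group" "s \<in> carrier F" "vanishes_above s f"
      show "(\<ominus>\<^bsub>operators\<^esub> \<phi>) f (a \<otimes>\<^bsub>F\<^esub> s) = \<ominus>\<^bsub>L\<^esub> l \<otimes>\<^bsub>L\<^esub> f s"
        using operator_uminus_apply[OF U(3) f(1), of "a \<otimes>\<^bsub>F\<^esub> s"] U(1,2) U(5)[OF f] f by (simp add: L.l_minus)
      show "(\<ominus>\<^bsub>operators\<^esub> \<phi>) f x = \<zero>\<^bsub>L\<^esub>"
        if x: "x \<in> carrier F" "(a \<otimes>\<^bsub>F\<^esub> s, x) \<in> leq" "x \<noteq> a \<otimes>\<^bsub>F\<^esub> s" for x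
        using operator_uminus_apply[OF U(3) f(1) x(1)] U(4)[OF f x] by simp
    qed (use U(1,2) in auto)
    then show ?thesis
      unfolding p using U(1,2) by simp
  qed
qed

text \<open>
  The ELT value of an expression is a leading term of its value at the operators: the bridge from
  ELT rings to rings.
\<close>

lemma has_leading_term_poly_eval:
  assumes "\<And>v. r v \<in> carrier (elt_ring L F leq)"
  shows "has_leading_term (poly_eval (elt_ring L F leq) (elt_neg L F leq) r X)
    (poly_eval operators (a_inv operators) (weighted_shift \<circ> r) X)"
  by (rule poly_eval_rel[of has_leading_term])
    (use assms has_leading_term_one in \<open>auto intro: has_leading_term_add has_leading_term_mult
       has_leading_term_uminus has_leading_term_weighted_shift simp del: endomorphism_ring_simps\<close>)

definition delta :: "'f \<Rightarrow> 'l" where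
  "delta = (\<lambda>x\<in>carrier F. if x = \<one>\<^bsub>F\<^esub> then \<one>\<^bsub>L\<^esub> else \<zero>\<^bsub>L\<^esub>)"

text \<open>
  The function that \<open>\<phi>\<close> assigns to the delta function is the coefficient function of \<open>\<phi>\<close>, regarded as
  an element of the group algebra.
\<close>

lemma leading_layer_eq_delta:
  assumes "has_leading_term (Some (l, a)) \<phi>"
  shows "\<phi> delta a = l"
    and "\<And>x. (a, x) \<in> leq \<Longrightarrow> x \<noteq> a \<Longrightarrow> \<phi> delta x = \<zero>\<^bsub>L\<^esub>"
proof -
  have "delta \<in> carrier fun_group" "vanishes_above \<one>\<^bsub>F\<^esub> delta" and d1: "delta \<one>\<^bsub>F\<^esub> = \<one>\<^bsub>L\<^esub>"
    by (auto simp: delta_def vanishes_above_def)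
  then show "\<phi> delta a = l" "\<And>x. (a, x) \<in> leq \<Longrightarrow> x \<noteq> a \<Longrightarrow> \<phi> delta x = \<zero>\<^bsub>L\<^esub>"
    using has_leading_term_SomeD[OF assms] F.leq_carrier by (metis F.one_closed F.r_one L.r_one)+
qed

text \<open>
  Two leading terms of one operator with the same exponent agree. If the exponents differ, the larger
  one lies above everything that occurs in \<open>\<phi>\<close>, so its layer is zero and it can itself serve as the
  summand of layer zero.
\<close>

lemma elt_surpasses_if_same_operator:
  assumes u: "has_leading_term u \<phi>" and v: "has_leading_term v \<phi>"
    and ge: "max_plus_ge leq (map_option snd u) (map_option snd v)"
  shows "elt_surpasses L F leq u v"
proof -
  have surpassI: "elt_surpasses L F leq u v"
    if "z \<in> carrier (elt_ring L F leq)" "elt_layer L z = \<zero>\<^bsub>L\<^esub>" "u = v \<oplus>\<^bsub>elt_ring L F leq\<^esub> z" for z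
    unfolding elt_surpasses_def using that by blast
  have uc: "u \<in> carrier (elt_ring L F leq)"
    using u by (simp add: has_leading_term_def)
  show ?thesis
  proof (cases "u = v")
    case True
    then show ?thesis
      using surpassI[of None] by simp
  next
    case False
    with ge have "u \<noteq> None"
      by (cases u; cases v) auto
    then obtain l a where ueq: "u = Some (l, a)"
      by auto
    note U = leading_layer_eq_delta[OF u[unfolded ueq]]
    have "a \<in> carrier F"
      using uc ueq by auto
    have "l = \<zero>\<^bsub>L\<^esub> \<and> u = v \<oplus>\<^bsub>elt_ring L F leq\<^esub> u"
    proof (cases v)
      case None
      have "delta \<in> carrier fun_group"
        by (auto simp: delta_def)
      then have "\<phi> delta a = \<zero>\<^bsub>L\<^esub>"
        using v None \<open>a \<in> carrier F\<close> by simp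
      then show ?thesis
        using U(1) None by simp
    next
      case (Some q)
      then obtain k b where veq: "v = Some (k, b)"
        by (cases q) auto
      note V = leading_layer_eq_delta[OF v[unfolded veq]]
      have "(b, a) \<in> leq"
        using ge by (simp add: ueq veq)
      moreover have "a \<noteq> b"
        using U(1) V(1) False ueq veq by auto
      ultimately show ?thesis
        using U(1) V(2) ueq veq F.leq_antisym by auto
    qed
    moreover have "elt_layer L u = l"
      by (simp add: ueq)
    ultimately show ?thesis
      using surpassI[OF uc] by blast
  qed
qed

end

theorem theorem2p10:
  fixes P Q :: "nat poly_expr" and m :: nat
    and L :: "'l ring" and F :: "'f monoid" and leqF :: "('f \<times> 'f) set"
  assumes vars: "poly_vars P \<subseteq> {1..m}" "poly_vars Q \<subseteq> {1..m}"
    and rings: "\<And>R :: ('u :: infinite) ring. cring R \<Longrightarrow> identity_holds m R (a_inv R) (=) P Q"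
    and tropical: "\<And>(G :: 'u monoid) leq. totally_ordered_abelian_group G leq \<Longrightarrow>
      identity_holds m (max_plus G leq) (\<lambda>a. a) (max_plus_ge leq) P Q"
    and L: "cring L" and F: "totally_ordered_abelian_group F leqF"
  shows "identity_holds m (elt_ring L F leqF) (elt_neg L F leqF) (elt_surpasses L F leqF) P Q"
proof -
  interpret elt_ring_data L F leqF
    using L F by (simp add: elt_ring_data_def)
  let ?R = "elt_ring L F leqF" and ?neg = "elt_neg L F leqF"
  have "elt_surpasses L F leqF (poly_eval ?R ?neg r P) (poly_eval ?R ?neg r Q)"
    if r: "\<forall>i\<in>{1..m}. r i \<in> carrier ?R" for r
  proof -
    \<comment> \<open>Only the variables \<open>1, \<dots>, m\<close> occur; the others get the value minus infinity, so that every
      variable has a value in the carrier.\<close>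
    define r' where "r' = (\<lambda>i. if i \<in> {1..m} then r i else None)"
    have r': "r' i \<in> carrier ?R" for i
      using r by (simp add: r'_def)
    have "poly_eval operators (a_inv operators) (weighted_shift \<circ> r') P =
        poly_eval operators (a_inv operators) (weighted_shift \<circ> r') Q"
    proof (rule ring_identity_at_commuting[OF rings])
      show "ring operators"
        by (intro comm_group.ring_endomorphism_ring comm_group_fun_group)
    qed (use r' weighted_shift_closed weighted_shifts_commute in \<open>simp_all del: endomorphism_ring_simps\<close>)
    moreover have "max_plus_ge leqF (map_option snd (poly_eval ?R ?neg r' P))
        (map_option snd (poly_eval ?R ?neg r' Q))"
    proof -
      have "(map_option snd \<circ> r') i \<in> carrier (max_plus F leqF)" for i
        using r'[of i] by auto
      from tropical_inequality_everywhere[of m P Q F leqF "map_option snd \<circ> r'", OF tropical F this]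
      show ?thesis
        using poly_eval_elt_ring[of r', OF r'] by simp
    qed
    ultimately have "elt_surpasses L F leqF (poly_eval ?R ?neg r' P) (poly_eval ?R ?neg r' Q)"
      using has_leading_term_poly_eval[of r', OF r'] elt_surpasses_if_same_operator by metis
    moreover have "poly_eval ?R ?neg r' X = poly_eval ?R ?neg r X" if "poly_vars X \<subseteq> {1..m}" for X
      using that by (intro poly_eval_cong) (auto simp: r'_def)
    ultimately show ?thesis
      using vars by simp
  qed
  then show ?thesis
    by (simp add: identity_holds_def)
qed

end
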